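(* Let $N \ge 1$, let $\mathbf{J} = \{J_x\}_{x=0}^{N-1}$ be nonnegative real coupling constants, let $\mathbf{h} = \{h_x\}_{x=0}^{N}$ be nonnegative real external fields, and let $i<j$ be two points of $\{0,\ldots,N\}$. Let $h'_i, h'_j \in \mathbb{R}$ be the effective fields at $i$ and $j$ obtained by integrating out all spins at sites outside $\{i,\ldots,j\}$. Then $$\operatorname{cov}_{\mathbf{J},\mathbf{h}}(\sigma_i,\sigma_j) \le \left( \prod_{x=i}^{j-1} \frac{4\tanh(J_x)}{(1+\tanh(J_x))^2} \right) \frac{1}{\cosh^2\left( h'_i + \sum_{x=i+1}^{j-1} h_x + h'_j \right)}.$$
   Context: One-dimensional Ising model on $\{0,\ldots,N\}$ with free boundary conditions: for a spin configuration $\boldsymbol{\sigma} = (\sigma_0,\ldots,\sigma_N) \in \{\pm1\}^{N+1}$ put $$H_{\mathbf{J},\mathbf{h}}(\boldsymbol{\sigma}) = -\sum_{x=0}^{N-1} J_x \sigma_x\sigma_{x+1} - \sum_{x=0}^{N} h_x\sigma_x.$$ The Gibbs measure is $\mu_{\mathbf{J},\mathbf{h}}(\boldsymbol{\sigma}) = \exp(-H_{\mathbf{J},\mathbf{h}}(\boldsymbol{\sigma}))/Z_{\mathbf{J},\mathbf{h}}$, where $Z_{\mathbf{J},\mathbf{h}} = \sum_{\boldsymbol{\sigma}\in\{\pm1\}^{N+1}} \exp(-H_{\mathbf{J},\mathbf{h}}(\boldsymbol{\sigma}))$, and $\operatorname{cov}_{\mathbf{J},\mathbf{h}}$ denotes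 covariance under $\mu_{\mathbf{J},\mathbf{h}}$. Effective fields: for $i<j$, $h'_i$ and $h'_j$ are the (unique) real numbers such that the marginal of $\mu_{\mathbf{J},\mathbf{h}}$ on $(\sigma_i,\ldots,\sigma_j)$ equals the Gibbs measure on $\{\pm1\}^{j-i+1}$ proportional to $$\exp\left( \sum_{x=i}^{j-1} J_x\sigma_x\sigma_{x+1} + h'_i\sigma_i + \sum_{x=i+1}^{j-1} h_x\sigma_x + h'_j\sigma_j \right).$$ In particular $h'_i=h_i$ if $i=0$ and $h'_j=h_j$ if $j=N$. Empty sums are $0$. *)

theory Defs
  imports "HOL-Probability.Probability"
begin

text \<open>
  Everything is set up for a chain whose sites form an interval \<open>{a..b}\<close>: the full model is the
  chain \<open>{0..N}\<close>, and the target of the effective fields is the chain \<open>{i..j}\<close>.  A configuration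
  is a real-valued function with values \<open>-1\<close>, \<open>1\<close> on the sites and \<open>undefined\<close> elsewhere.
  \<open>J x\<close> couples \<open>x\<close> and \<open>Suc x\<close>.
\<close>

definition spin_configs :: "nat \<Rightarrow> nat \<Rightarrow> (nat \<Rightarrow> real) set" where
  "spin_configs a b = {a..b} \<rightarrow>\<^sub>E {-1, 1}"

definition hamiltonian ::
    "nat \<Rightarrow> nat \<Rightarrow> (nat \<Rightarrow> real) \<Rightarrow> (nat \<Rightarrow> real) \<Rightarrow> (nat \<Rightarrow> real) \<Rightarrow> real" where
  "hamiltonian a b J h \<sigma> =
     - (\<Sum>x\<in>{a..<b}. J x * \<sigma> x * \<sigma> (Suc x)) - (\<Sum>x\<in>{a..b}. h x * \<sigma> x)"

definition partition_function ::
    "nat \<Rightarrow> nat \<Rightarrow> (nat \<Rightarrow> real) \<Rightarrow> (nat \<Rightarrow> real) \<Rightarrow> real" where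
  "partition_function a b J h = (\<Sum>\<sigma>\<in>spin_configs a b. exp (- hamiltonian a b J h \<sigma>))"

definition gibbs_measure ::
    "nat \<Rightarrow> nat \<Rightarrow> (nat \<Rightarrow> real) \<Rightarrow> (nat \<Rightarrow> real) \<Rightarrow> (nat \<Rightarrow> real) pmf" where
  "gibbs_measure a b J h = embed_pmf (\<lambda>\<sigma>. if \<sigma> \<in> spin_configs a b
     then exp (- hamiltonian a b J h \<sigma>) / partition_function a b J h else 0)"

definition covariance :: "'a pmf \<Rightarrow> ('a \<Rightarrow> real) \<Rightarrow> ('a \<Rightarrow> real) \<Rightarrow> real" where
  "covariance p X Y = measure_pmf.expectation p
     (\<lambda>\<omega>. (X \<omega> - measure_pmf.expectation p X) * (Y \<omega> - measure_pmf.expectation p Y))"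

definition effective_fields ::
    "nat \<Rightarrow> (nat \<Rightarrow> real) \<Rightarrow> (nat \<Rightarrow> real) \<Rightarrow> nat \<Rightarrow> nat \<Rightarrow> real \<Rightarrow> real \<Rightarrow> bool" where
  "effective_fields N J h i j hi' hj' \<longleftrightarrow>
     map_pmf (\<lambda>\<sigma>. restrict \<sigma> {i..j}) (gibbs_measure 0 N J h)
       = gibbs_measure i j J (h(i := hi', j := hj'))"


lemma finite_spin_configs [simp]: "finite (spin_configs a b)"
  by (auto simp: spin_configs_def intro!: finite_PiE)

lemma spin_configs_ne [simp]: "spin_configs a b \<noteq> {}"
  by (simp add: spin_configs_def PiE_eq_empty_iff)

lemma partition_function_pos: "partition_function a b J h > 0"
  unfolding partition_function_def by (intro sum_pos) auto

lemma pmf_gibbs_measure: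
  "pmf (gibbs_measure a b J h) \<sigma> = (if \<sigma> \<in> spin_configs a b
     then exp (- hamiltonian a b J h \<sigma>) / partition_function a b J h else 0)"
  unfolding gibbs_measure_def
proof (rule pmf_embed_pmf)
  let ?f = "\<lambda>\<sigma>. if \<sigma> \<in> spin_configs a b
     then exp (- hamiltonian a b J h \<sigma>) / partition_function a b J h else 0"
  show nn: "0 \<le> ?f \<sigma>" for \<sigma>
    using partition_function_pos[of a b J h] by auto
  have "(\<integral>\<^sup>+\<sigma>. ennreal (?f \<sigma>) \<partial>count_space UNIV) = (\<Sum>\<sigma>\<in>spin_configs a b. ennreal (?f \<sigma>))"
    by (rule nn_integral_count_space'[OF finite_spin_configs]) auto
  also have "\<dots> = ennreal (\<Sum>\<sigma>\<in>spin_configs a b. ?f \<sigma>)"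
    using nn by (rule sum_ennreal)
  also have "(\<Sum>\<sigma>\<in>spin_configs a b. ?f \<sigma>) = 1"
    using partition_function_pos[of a b J h]
    by (simp add: partition_function_def flip: sum_divide_distrib)
  finally show "(\<integral>\<^sup>+\<sigma>. ennreal (?f \<sigma>) \<partial>count_space UNIV) = 1"
    by simp
qed

lemma set_gibbs_measure: "set_pmf (gibbs_measure a b J h) = spin_configs a b"
  using partition_function_pos[of a b J h] by (auto simp: set_pmf_eq pmf_gibbs_measure)

lemma marginal_gibbs_measure:
  assumes sub: "a \<le> a'" "b' \<le> b"
    and weight: "\<And>\<sigma>. \<sigma> \<in> spin_configs a' b' \<Longrightarrow>
      (\<Sum>\<tau>\<in>{\<tau> \<in> spin_configs a b. restrict \<tau> {a'..b'} = \<sigma>}. exp (- hamiltonian a b J h \<tau>))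
        = c * exp (- hamiltonian a' b' J' h' \<sigma>)"
  shows "map_pmf (\<lambda>\<sigma>. restrict \<sigma> {a'..b'}) (gibbs_measure a b J h) = gibbs_measure a' b' J' h'"
proof (rule pmf_eqI)
  fix \<sigma>
  let ?r = "\<lambda>\<tau>. restrict \<tau> {a'..b'}" and ?Z = "partition_function a b J h"
  let ?F = "\<lambda>\<sigma>. {\<tau> \<in> spin_configs a b. ?r \<tau> = \<sigma>}"
  have r: "?r ` spin_configs a b \<subseteq> spin_configs a' b'"
  proof (intro image_subsetI)
    fix \<tau> assume "\<tau> \<in> spin_configs a b"
    then have "\<tau> x \<in> {-1, 1}" if "x \<in> {a'..b'}" for x
      using sub that unfolding spin_configs_def by (intro PiE_mem[of \<tau> "{a..b}"]) auto
    then show "?r \<tau> \<in> spin_configs a' b'"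
      unfolding spin_configs_def restrict_PiE_iff by blast
  qed
  have Z: "?Z = c * partition_function a' b' J' h'"
    unfolding partition_function_def sum_distrib_left
    by (subst sum.group[OF finite_spin_configs finite_spin_configs r, symmetric])
       (simp add: weight)
  have c: "c \<noteq> 0"
    using Z partition_function_pos[of a b J h] by auto
  have "pmf (map_pmf ?r (gibbs_measure a b J h)) \<sigma>
      = measure (gibbs_measure a b J h) (?r -` {\<sigma>})"
    by (rule pmf_map)
  also have "\<dots> = measure (gibbs_measure a b J h) (?F \<sigma>)"
    by (intro measure_pmf.finite_measure_eq_AE) (auto simp: AE_measure_pmf_iff set_gibbs_measure)
  also have "\<dots> = (\<Sum>\<tau>\<in>?F \<sigma>. exp (- hamiltonian a b J h \<tau>)) / ?Z"
    by (subst measure_measure_pmf_finite)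
       (auto simp: pmf_gibbs_measure sum_divide_distrib intro!: sum.cong)
  also have "\<dots> = pmf (gibbs_measure a' b' J' h') \<sigma>"
  proof (cases "\<sigma> \<in> spin_configs a' b'")
    case True
    then show ?thesis using c by (simp add: weight pmf_gibbs_measure Z)
  next
    case False
    then have "?F \<sigma> = {}" using r by blast
    with False show ?thesis by (simp only: pmf_gibbs_measure) simp
  qed
  finally show "pmf (map_pmf ?r (gibbs_measure a b J h)) \<sigma> = pmf (gibbs_measure a' b' J' h') \<sigma>" .
qed

lemma single_spin_sum:
  obtains c \<delta> :: real where
    "\<And>s::real. s \<in> {-1, 1} \<Longrightarrow> (\<Sum>t\<in>{-1, 1::real}. exp (K * s * t + g * t)) = c * exp (\<delta> * s)"
proof -
  define P where "P = exp (K + g) + exp (- K - g)"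
  define M where "M = exp (- K + g) + exp (K - g)"
  have pos: "P > 0" "M > 0" by (auto simp: P_def M_def add_pos_pos)
  show ?thesis
  proof (rule that)
    fix s :: real assume s: "s \<in> {-1, 1}"
    have "ln P = (ln P + ln M) / 2 + (ln P - ln M) / 2 * 1"
      by (simp add: field_simps)
    then have P: "P = exp ((ln P + ln M) / 2) * exp ((ln P - ln M) / 2 * 1)"
      using pos by (metis exp_add exp_ln)
    have "ln M = (ln P + ln M) / 2 + (ln P - ln M) / 2 * (-1)"
      by (simp add: field_simps)
    then have M: "M = exp ((ln P + ln M) / 2) * exp ((ln P - ln M) / 2 * (-1))"
      using pos by (metis exp_add exp_ln)
    have 1: "(\<Sum>t\<in>{-1, 1::real}. exp (K * 1 * t + g * t)) = P"
      by (simp add: P_def)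
    have m1: "(\<Sum>t\<in>{-1, 1::real}. exp (K * (-1) * t + g * t)) = M"
      by (simp add: M_def)
    from s consider "s = -1" | "s = 1" by blast
    then show "(\<Sum>t\<in>{-1, 1::real}. exp (K * s * t + g * t))
        = exp ((ln P + ln M) / 2) * exp ((ln P - ln M) / 2 * s)"
      by cases (simp_all only: 1 m1 P[symmetric] M[symmetric])
  qed
qed

lemma restrict_fiber:
  assumes "\<sigma> \<in> A \<rightarrow>\<^sub>E B" "x \<notin> A"
  shows "{\<tau> \<in> insert x A \<rightarrow>\<^sub>E B. restrict \<tau> A = \<sigma>} = (\<lambda>t. \<sigma>(x := t)) ` B"
proof (intro equalityI subsetI)
  fix \<tau> assume \<tau>: "\<tau> \<in> {\<tau> \<in> insert x A \<rightarrow>\<^sub>E B. restrict \<tau> A = \<sigma>}"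
  then have "\<tau> = \<sigma>(x := \<tau> x)"
    by (auto simp: fun_eq_iff restrict_def PiE_def extensional_def) metis
  moreover have "\<tau> x \<in> B" using \<tau> by auto
  ultimately show "\<tau> \<in> (\<lambda>t. \<sigma>(x := t)) ` B" by blast
next
  fix \<tau> assume "\<tau> \<in> (\<lambda>t. \<sigma>(x := t)) ` B"
  with assms show "\<tau> \<in> {\<tau> \<in> insert x A \<rightarrow>\<^sub>E B. restrict \<tau> A = \<sigma>}"
    by (auto simp: fun_eq_iff restrict_def PiE_def extensional_def Pi_def)
qed

lemma sum_fun_upd_at:
  fixes h g :: "nat \<Rightarrow> real"
  assumes "finite A" "x \<in> A"
  shows "(\<Sum>y\<in>A. (h(x := v)) y * g y) = (\<Sum>y\<in>A. h y * g y) + (v - h x) * g x"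
  using assms by (simp add: sum.remove algebra_simps)

lemma remove_last_site:
  assumes "a \<le> b"
  shows "\<exists>h'. map_pmf (\<lambda>\<sigma>. restrict \<sigma> {a..b}) (gibbs_measure a (Suc b) J h)
    = gibbs_measure a b J (h(b := h'))"
proof -
  obtain c \<delta> where c: "\<And>s::real. s \<in> {-1, 1} \<Longrightarrow>
      (\<Sum>t\<in>{-1, 1::real}. exp (J b * s * t + h (Suc b) * t)) = c * exp (\<delta> * s)"
    by (rule single_spin_sum[of "J b" "h (Suc b)"]) blast
  have "map_pmf (\<lambda>\<sigma>. restrict \<sigma> {a..b}) (gibbs_measure a (Suc b) J h)
    = gibbs_measure a b J (h(b := h b + \<delta>))"
  proof (rule marginal_gibbs_measure[where c = c])
    fix \<sigma> assume \<sigma>: "\<sigma> \<in> spin_configs a b"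
    have ins: "{a..Suc b} = insert (Suc b) {a..b}" using assms by auto
    have s: "\<sigma> b \<in> {-1, 1}"
      using \<sigma> assms unfolding spin_configs_def by (intro PiE_mem[of \<sigma> "{a..b}"]) auto
    have fib: "{\<tau> \<in> spin_configs a (Suc b). restrict \<tau> {a..b} = \<sigma>}
        = (\<lambda>t. \<sigma>(Suc b := t)) ` {-1, 1}"
      using restrict_fiber[of \<sigma> "{a..b}" "{-1,1}" "Suc b"] \<sigma>
      by (simp add: spin_configs_def ins)
    have inj: "inj_on (\<lambda>t. \<sigma>(Suc b := t)) {-1, 1}"
      by (rule inj_onI) (metis fun_upd_same)
    have H: "- hamiltonian a (Suc b) J h (\<sigma>(Suc b := t))
        = - hamiltonian a b J h \<sigma> + (J b * \<sigma> b * t + h (Suc b) * t)" for t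
    proof -
      have 1: "(\<Sum>x\<in>{a..<Suc b}. J x * (\<sigma>(Suc b := t)) x * (\<sigma>(Suc b := t)) (Suc x))
          = (\<Sum>x\<in>{a..<b}. J x * \<sigma> x * \<sigma> (Suc x)) + J b * \<sigma> b * t"
        using assms by (simp add: atLeastLessThanSuc)
      have 2: "(\<Sum>x\<in>{a..Suc b}. h x * (\<sigma>(Suc b := t)) x)
          = (\<Sum>x\<in>{a..b}. h x * \<sigma> x) + h (Suc b) * t"
        using assms by (simp add: atLeastAtMostSuc_conv)
      show ?thesis unfolding hamiltonian_def 1 2 by simp
    qed
    have H': "- hamiltonian a b J (h(b := h b + \<delta>)) \<sigma> = - hamiltonian a b J h \<sigma> + \<delta> * \<sigma> b"
      unfolding hamiltonian_def using assms by (subst sum_fun_upd_at) auto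
    show "(\<Sum>\<tau>\<in>{\<tau> \<in> spin_configs a (Suc b). restrict \<tau> {a..b} = \<sigma>}.
        exp (- hamiltonian a (Suc b) J h \<tau>)) = c * exp (- hamiltonian a b J (h(b := h b + \<delta>)) \<sigma>)"
      unfolding fib sum.reindex[OF inj] comp_def H H' exp_add sum_distrib_left[symmetric]
      using c[OF s] by (simp add: exp_add)
  qed auto
  then show ?thesis by blast
qed

lemma remove_first_site:
  assumes "Suc a \<le> b"
  shows "\<exists>h'. map_pmf (\<lambda>\<sigma>. restrict \<sigma> {Suc a..b}) (gibbs_measure a b J h)
    = gibbs_measure (Suc a) b J (h(Suc a := h'))"
proof -
  obtain c \<delta> where c: "\<And>s::real. s \<in> {-1, 1} \<Longrightarrow>
      (\<Sum>t\<in>{-1, 1::real}. exp (J a * s * t + h a * t)) = c * exp (\<delta> * s)"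
    by (rule single_spin_sum[of "J a" "h a"]) blast
  have "map_pmf (\<lambda>\<sigma>. restrict \<sigma> {Suc a..b}) (gibbs_measure a b J h)
    = gibbs_measure (Suc a) b J (h(Suc a := h (Suc a) + \<delta>))"
  proof (rule marginal_gibbs_measure[where c = c])
    fix \<sigma> assume \<sigma>: "\<sigma> \<in> spin_configs (Suc a) b"
    have ins: "{a..b} = insert a {Suc a..b}" using assms by auto
    have s: "\<sigma> (Suc a) \<in> {-1, 1}"
      using \<sigma> assms unfolding spin_configs_def by (intro PiE_mem[of \<sigma> "{Suc a..b}"]) auto
    have fib: "{\<tau> \<in> spin_configs a b. restrict \<tau> {Suc a..b} = \<sigma>}
        = (\<lambda>t. \<sigma>(a := t)) ` {-1, 1}"
      using restrict_fiber[of \<sigma> "{Suc a..b}" "{-1,1}" a] \<sigma>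
      by (simp add: spin_configs_def ins)
    have inj: "inj_on (\<lambda>t. \<sigma>(a := t)) {-1, 1}"
      by (rule inj_onI) (metis fun_upd_same)
    have H: "- hamiltonian a b J h (\<sigma>(a := t))
        = - hamiltonian (Suc a) b J h \<sigma> + (J a * \<sigma> (Suc a) * t + h a * t)" for t
    proof -
      have 1: "(\<Sum>x\<in>{a..<b}. J x * (\<sigma>(a := t)) x * (\<sigma>(a := t)) (Suc x))
          = (\<Sum>x\<in>{Suc a..<b}. J x * \<sigma> x * \<sigma> (Suc x)) + J a * \<sigma> (Suc a) * t"
        using assms by (simp add: sum.atLeast_Suc_lessThan)
      have 2: "(\<Sum>x\<in>{a..b}. h x * (\<sigma>(a := t)) x)
          = (\<Sum>x\<in>{Suc a..b}. h x * \<sigma> x) + h a * t"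
        using assms by (simp add: sum.atLeast_Suc_atMost)
      show ?thesis unfolding hamiltonian_def 1 2 by simp
    qed
    have H': "- hamiltonian (Suc a) b J (h(Suc a := h (Suc a) + \<delta>)) \<sigma>
        = - hamiltonian (Suc a) b J h \<sigma> + \<delta> * \<sigma> (Suc a)"
      unfolding hamiltonian_def using assms by (subst sum_fun_upd_at) auto
    show "(\<Sum>\<tau>\<in>{\<tau> \<in> spin_configs a b. restrict \<tau> {Suc a..b} = \<sigma>}.
        exp (- hamiltonian a b J h \<tau>))
        = c * exp (- hamiltonian (Suc a) b J (h(Suc a := h (Suc a) + \<delta>)) \<sigma>)"
      unfolding fib sum.reindex[OF inj] comp_def H H' exp_add sum_distrib_left[symmetric]
      using c[OF s] by (simp add: exp_add)
  qed auto
  then show ?thesis by blast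
qed

lemma map_restrict_gibbs_measure:
  assumes "a \<le> b"
  shows "map_pmf (\<lambda>\<sigma>. restrict \<sigma> {a..b}) (gibbs_measure a b J h) = gibbs_measure a b J h"
proof -
  have "map_pmf (\<lambda>\<sigma>. restrict \<sigma> {a..b}) (gibbs_measure a b J h)
      = map_pmf (\<lambda>\<sigma>. \<sigma>) (gibbs_measure a b J h)"
    by (rule map_pmf_cong) (auto simp: set_gibbs_measure spin_configs_def)
  then show ?thesis by simp
qed

lemma remove_right:
  assumes "b \<le> B" "a \<le> b"
  shows "\<exists>h'. map_pmf (\<lambda>\<sigma>. restrict \<sigma> {a..b}) (gibbs_measure a B J h)
    = gibbs_measure a b J (h(b := h'))"
  using assms
proof (induction B arbitrary: h rule: dec_induct)
  case base
  then show ?case by (intro exI[of _ "h b"]) (simp only: fun_upd_triv map_restrict_gibbs_measure)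
next
  case (step n)
  then have "a \<le> n" by simp
  obtain h1 where h1: "map_pmf (\<lambda>\<sigma>. restrict \<sigma> {a..n}) (gibbs_measure a (Suc n) J h)
      = gibbs_measure a n J (h(n := h1))"
    using remove_last_site[OF \<open>a \<le> n\<close>] by blast
  obtain h2 where h2: "map_pmf (\<lambda>\<sigma>. restrict \<sigma> {a..b}) (gibbs_measure a n J (h(n := h1)))
      = gibbs_measure a b J (h(n := h1, b := h2))"
    using step.IH[OF step.prems] by blast
  have "map_pmf (\<lambda>\<sigma>. restrict \<sigma> {a..b}) (gibbs_measure a (Suc n) J h)
      = gibbs_measure a b J (h(n := h1, b := h2))"
    unfolding h2[symmetric] h1[symmetric] map_pmf_comp
    using step.hyps by (simp add: Int_absorb1)
  also have "\<dots> = gibbs_measure a b J (h(b := h2))"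
  proof -
    have "hamiltonian a b J (h(n := h1, b := h2)) = hamiltonian a b J (h(b := h2))"
      unfolding hamiltonian_def using step.hyps
      by (intro ext arg_cong2[where f = minus] refl sum.cong) auto
    then show ?thesis by (simp only: gibbs_measure_def partition_function_def)
  qed
  finally show ?case by blast
qed

lemma remove_left:
  assumes "A \<le> a" "a \<le> b"
  shows "\<exists>h'. map_pmf (\<lambda>\<sigma>. restrict \<sigma> {a..b}) (gibbs_measure A b J h)
    = gibbs_measure a b J (h(a := h'))"
  using assms
proof (induction A arbitrary: h rule: inc_induct)
  case base
  then show ?case by (intro exI[of _ "h a"]) (simp only: fun_upd_triv map_restrict_gibbs_measure)
next
  case (step n)
  then have "Suc n \<le> b" by simp
  obtain h1 where h1: "map_pmf (\<lambda>\<sigma>. restrict \<sigma> {Suc n..b}) (gibbs_measure n b J h)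
      = gibbs_measure (Suc n) b J (h(Suc n := h1))"
    using remove_first_site[OF \<open>Suc n \<le> b\<close>] by blast
  obtain h2 where h2: "map_pmf (\<lambda>\<sigma>. restrict \<sigma> {a..b}) (gibbs_measure (Suc n) b J (h(Suc n := h1)))
      = gibbs_measure a b J (h(Suc n := h1, a := h2))"
    using step.IH[OF step.prems] by blast
  have "map_pmf (\<lambda>\<sigma>. restrict \<sigma> {a..b}) (gibbs_measure n b J h)
      = gibbs_measure a b J (h(Suc n := h1, a := h2))"
    unfolding h2[symmetric] h1[symmetric] map_pmf_comp
    using step.hyps by (simp add: Int_absorb1)
  also have "\<dots> = gibbs_measure a b J (h(a := h2))"
  proof -
    have "hamiltonian a b J (h(Suc n := h1, a := h2)) = hamiltonian a b J (h(a := h2))"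
      unfolding hamiltonian_def using step.hyps
      by (intro ext arg_cong2[where f = minus] refl sum.cong) auto
    then show ?thesis by (simp only: gibbs_measure_def partition_function_def)
  qed
  finally show ?case by blast
qed

lemma effective_fields_exist:
  assumes "i < j" "j \<le> N"
  shows "\<exists>hi' hj'. effective_fields N J h i j hi' hj'"
proof -
  obtain hj' where hj': "map_pmf (\<lambda>\<sigma>. restrict \<sigma> {0..j}) (gibbs_measure 0 N J h)
      = gibbs_measure 0 j J (h(j := hj'))"
    using remove_right[of j N 0] assms by auto
  obtain hi' where hi': "map_pmf (\<lambda>\<sigma>. restrict \<sigma> {i..j}) (gibbs_measure 0 j J (h(j := hj')))
      = gibbs_measure i j J (h(j := hj', i := hi'))"
    using remove_left[of 0 i j] assms by auto
  have "map_pmf (\<lambda>\<sigma>. restrict \<sigma> {i..j}) (gibbs_measure 0 N J h)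
      = gibbs_measure i j J (h(j := hj', i := hi'))"
    unfolding hi'[symmetric] hj'[symmetric] map_pmf_comp by (simp add: Int_absorb1)
  then show ?thesis
    using assms by (auto simp: effective_fields_def fun_upd_twist)
qed

lemma effective_fields_unique:
  assumes "i < j" "effective_fields N J h i j p q" "effective_fields N J h i j p' q'"
  shows "p = p' \<and> q = q'"
proof -
  define C where "C = ln (partition_function i j J (h(i := p, j := q)))
    - ln (partition_function i j J (h(i := p', j := q')))"
  have eq: "gibbs_measure i j J (h(i := p, j := q)) = gibbs_measure i j J (h(i := p', j := q'))"
    using assms(2,3) by (simp add: effective_fields_def)
  have "(p - p') * \<sigma> i + (q - q') * \<sigma> j = C" if \<sigma>: "\<sigma> \<in> spin_configs i j" for \<sigma>
  proof -
    have ham: "hamiltonian i j J (h(i := u, j := v)) \<sigma>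
        = hamiltonian i j J h \<sigma> - (u - h i) * \<sigma> i - (v - h j) * \<sigma> j" for u v
      unfolding hamiltonian_def using assms(1) by (simp add: sum_fun_upd_at del: fun_upd_apply) simp
    have "exp (- hamiltonian i j J (h(i := p, j := q)) \<sigma>)
          / partition_function i j J (h(i := p, j := q))
        = exp (- hamiltonian i j J (h(i := p', j := q')) \<sigma>)
          / partition_function i j J (h(i := p', j := q'))"
      using arg_cong[OF eq, of "\<lambda>m. pmf m \<sigma>"] \<sigma> unfolding pmf_gibbs_measure by simp
    from arg_cong[OF this, of ln] show ?thesis
      using partition_function_pos[of i j J "h(i := p, j := q)"]
        partition_function_pos[of i j J "h(i := p', j := q')"] unfolding C_def
      by (simp add: ln_div ham algebra_simps del: fun_upd_apply)
  qed
  note * = this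
  have "(p - p') + (q - q') = C"
    using *[of "restrict (\<lambda>x. 1) {i..j}"] assms(1) by (auto simp: spin_configs_def)
  moreover have "- (p - p') + (q - q') = C"
    using *[of "restrict (\<lambda>x. if x = i then -1 else 1) {i..j}"] assms(1)
    by (auto simp: spin_configs_def)
  moreover have "(p - p') - (q - q') = C"
    using *[of "restrict (\<lambda>x. if x = j then -1 else 1) {i..j}"] assms(1)
    by (auto simp: spin_configs_def)
  ultimately show ?thesis by linarith
qed

text \<open>The effective fields are well defined, whatever the signs of the couplings and fields.\<close>

lemma effective_fields_ex1:
  assumes "i < j" "j \<le> N"
  shows "\<exists>!(hi', hj'). effective_fields N J h i j hi' hj'"
proof -
  obtain p q where pq: "effective_fields N J h i j p q"
    using effective_fields_exist[OF assms] by blast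
  show ?thesis
  proof (rule ex1I[of _ "(p, q)"])
    show "case (p, q) of (hi', hj') \<Rightarrow> effective_fields N J h i j hi' hj'"
      using pq by simp
    show "y = (p, q)" if "case y of (hi', hj') \<Rightarrow> effective_fields N J h i j hi' hj'" for y
      using that effective_fields_unique[OF assms(1) pq] by (cases y) auto
  qed
qed

end

theory Submission
  imports Defs
begin

text \<open>
  Integrating out the sites outside \<open>{i..j}\<close> leaves the joint law of \<open>\<sigma> i\<close> and \<open>\<sigma> j\<close> unchanged,
  so the covariance may be computed in the chain \<open>{i..j}\<close> with the effective fields at its ends.
  There, write \<open>W s t\<close> for the total weight of the configurations with end spins \<open>s\<close> and \<open>t\<close>, and
  \<open>Z\<close> for the partition function.  Two spins with values in \<open>{-1, 1}\<close> satisfy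
  \<open>cov = 4 * (W 1 1 * W (-1) (-1) - W 1 (-1) * W (-1) 1) / Z\<^sup>2\<close>, a multiple of the determinant of the
  \<open>2 \<times> 2\<close> matrix \<open>W\<close>.  This matrix is a product of transfer matrices: a bond with coupling \<open>J x\<close>
  contributes the factor \<open>exp (J x * s * t)\<close>, of determinant \<open>exp (2 J x) - exp (-2 J x)\<close>, and a
  site contributes a diagonal factor \<open>exp (h x * s)\<close>, of determinant one.  Hence the numerator does
  not depend on the fields at all (\<open>boundary_weight_det\<close>); since the couplings are nonnegative,
  each of its factors is nonnegative.

  The fields enter only through \<open>Z\<close>, and keeping just the two constant configurations in \<open>Z\<close> gives
  \<open>Z \<ge> 2 * exp (\<Sum>J) * cosh (\<Sum>h)\<close> (\<open>partition_function_ge_constant\<close>).  Dividing, each bond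
  contributes \<open>(exp (2 J x) - exp (-2 J x)) / exp (2 J x)\<close>, which is the factor
  \<open>4 tanh (J x) / (1 + tanh (J x))\<^sup>2\<close> of the bound.
\<close>

section \<open>Transfer matrices\<close>

definition boundary_weight ::
    "nat \<Rightarrow> nat \<Rightarrow> (nat \<Rightarrow> real) \<Rightarrow> (nat \<Rightarrow> real) \<Rightarrow> real \<Rightarrow> real \<Rightarrow> real" where
  "boundary_weight a b J h s t =
     (\<Sum>\<sigma>\<in>spin_configs a b. of_bool (\<sigma> a = s \<and> \<sigma> b = t) * exp (- hamiltonian a b J h \<sigma>))"

lemma spin_configs_value:
  assumes "\<sigma> \<in> spin_configs a b" "x \<in> {a..b}"
  shows "\<sigma> x = -1 \<or> \<sigma> x = 1"
  using PiE_mem[of \<sigma> "{a..b}" "\<lambda>_. {-1, 1}" x] assms by (simp add: spin_configs_def)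

lemma sum_PiE_insert:
  assumes "x \<notin> A"
  shows "(\<Sum>\<sigma>\<in>insert x A \<rightarrow>\<^sub>E B. F \<sigma>) = (\<Sum>\<sigma>\<in>A \<rightarrow>\<^sub>E B. \<Sum>t\<in>B. F (\<sigma>(x := t)))"
proof -
  have "(\<Sum>\<sigma>\<in>insert x A \<rightarrow>\<^sub>E B. F \<sigma>) = (\<Sum>(t, \<sigma>)\<in>B \<times> (A \<rightarrow>\<^sub>E B). F (\<sigma>(x := t)))"
    unfolding PiE_insert_eq using inj_combinator[OF assms, of "\<lambda>_. B"]
    by (subst sum.reindex) (simp_all add: case_prod_unfold)
  also have "\<dots> = (\<Sum>\<sigma>\<in>A \<rightarrow>\<^sub>E B. \<Sum>t\<in>B. F (\<sigma>(x := t)))"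
    by (simp add: sum.cartesian_product[symmetric]) (rule sum.swap)
  finally show ?thesis .
qed

lemma sum_spin_configs_singleton:
  "(\<Sum>\<sigma>\<in>spin_configs a a. F \<sigma>) = (\<Sum>t\<in>{-1, 1}. F ((\<lambda>_. undefined)(a := t)))"
  using sum_PiE_insert[of a "{}" F "{-1, 1}"] by (simp add: spin_configs_def fun_upd_def)

lemma sum_spin_configs_Suc:
  assumes "a \<le> b"
  shows "(\<Sum>\<sigma>\<in>spin_configs a (Suc b). F \<sigma>)
    = (\<Sum>\<sigma>\<in>spin_configs a b. \<Sum>t\<in>{-1, 1}. F (\<sigma>(Suc b := t)))"
proof -
  have "{a..Suc b} = insert (Suc b) {a..b}" using assms by auto
  then show ?thesis
    using sum_PiE_insert[of "Suc b" "{a..b}" F "{-1, 1}"] by (simp add: spin_configs_def)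
qed

lemma hamiltonian_Suc:
  assumes "a \<le> b"
  shows "hamiltonian a (Suc b) J h (\<sigma>(Suc b := t))
    = hamiltonian a b J h \<sigma> - (J b * \<sigma> b * t + h (Suc b) * t)"
proof -
  have 1: "(\<Sum>x\<in>{a..<Suc b}. J x * (\<sigma>(Suc b := t)) x * (\<sigma>(Suc b := t)) (Suc x))
      = (\<Sum>x\<in>{a..<b}. J x * \<sigma> x * \<sigma> (Suc x)) + J b * \<sigma> b * t"
    using assms by (simp add: atLeastLessThanSuc)
  have 2: "(\<Sum>x\<in>{a..Suc b}. h x * (\<sigma>(Suc b := t)) x)
      = (\<Sum>x\<in>{a..b}. h x * \<sigma> x) + h (Suc b) * t"
    using assms by (simp add: atLeastAtMostSuc_conv)
  show ?thesis unfolding hamiltonian_def 1 2 by simp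
qed

lemma sum_endpoints_eq_boundary_weight:
  assumes "a \<le> b"
  shows "(\<Sum>\<sigma>\<in>spin_configs a b. f (\<sigma> a) (\<sigma> b) * exp (- hamiltonian a b J h \<sigma>))
    = (\<Sum>s\<in>{-1, 1}. \<Sum>t\<in>{-1, 1}. f s t * boundary_weight a b J h s t)"
proof -
  have "f (\<sigma> a) (\<sigma> b) * e
      = (\<Sum>s\<in>{-1, 1}. \<Sum>t\<in>{-1, 1}. f s t * (of_bool (\<sigma> a = s \<and> \<sigma> b = t) * e))"
    if "\<sigma> \<in> spin_configs a b" for \<sigma> and e :: real
    using spin_configs_value[OF that, of a] spin_configs_value[OF that, of b] assms by auto
  then have "(\<Sum>\<sigma>\<in>spin_configs a b. f (\<sigma> a) (\<sigma> b) * exp (- hamiltonian a b J h \<sigma>))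
      = (\<Sum>\<sigma>\<in>spin_configs a b. \<Sum>s\<in>{-1, 1}. \<Sum>t\<in>{-1, 1}.
          f s t * (of_bool (\<sigma> a = s \<and> \<sigma> b = t) * exp (- hamiltonian a b J h \<sigma>)))"
    by (intro sum.cong refl)
  then show ?thesis
    by (simp add: boundary_weight_def sum_distrib_left sum.distrib
        del: sum_of_bool_mult_eq sum_mult_of_bool_eq)
qed

lemma boundary_weight_singleton:
  assumes "s \<in> {-1, 1}"
  shows "boundary_weight a a J h s t = of_bool (s = t) * exp (h a * s)"
  using assms by (auto simp: boundary_weight_def sum_spin_configs_singleton hamiltonian_def)

text \<open>Appending a site multiplies the matrix of boundary weights by one transfer matrix.\<close>

lemma boundary_weight_Suc:
  assumes "a \<le> b" "t \<in> {-1, 1}"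
  shows "boundary_weight a (Suc b) J h s t =
    (\<Sum>u\<in>{-1, 1}. boundary_weight a b J h s u * exp (J b * u * t + h (Suc b) * t))"
proof -
  have "boundary_weight a (Suc b) J h s t
      = (\<Sum>\<sigma>\<in>spin_configs a b. of_bool (\<sigma> a = s) * exp (J b * \<sigma> b * t + h (Suc b) * t)
          * exp (- hamiltonian a b J h \<sigma>))"
    unfolding boundary_weight_def sum_spin_configs_Suc[OF assms(1)] hamiltonian_Suc[OF assms(1)]
    using assms by (intro sum.cong refl) (auto simp: exp_add[symmetric] algebra_simps)
  also have "\<dots> = (\<Sum>\<sigma>\<in>spin_configs a b. \<Sum>u\<in>{-1, 1}.
      of_bool (\<sigma> a = s \<and> \<sigma> b = u) * exp (- hamiltonian a b J h \<sigma>)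
        * exp (J b * u * t + h (Suc b) * t))"
    using spin_configs_value[of _ a b b] assms(1) by (intro sum.cong refl) force
  finally show ?thesis
    unfolding boundary_weight_def by (simp add: sum_distrib_right sum.distrib
        del: sum_of_bool_mult_eq sum_mult_of_bool_eq)
qed

text \<open>
  Determinants multiply along the chain; the fields cancel since the transfer matrix of a site is
  diagonal with entries \<open>exp (h x)\<close> and \<open>exp (- h x)\<close>.
\<close>

lemma boundary_weight_det:
  fixes J h :: "nat \<Rightarrow> real"
  assumes "a \<le> b"
  defines "W \<equiv> boundary_weight a b J h"
  shows "W 1 1 * W (-1) (-1) - W 1 (-1) * W (-1) 1
    = (\<Prod>x\<in>{a..<b}. exp (2 * J x) - exp (- 2 * J x))"
  using assms(1) unfolding W_def
proof (induction b rule: dec_induct)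
  case base
  show ?case by (simp add: boundary_weight_singleton exp_minus)
next
  case (step n)
  let ?V = "boundary_weight a (Suc n) J h" and ?W = "boundary_weight a n J h"
  define A B p q where "A = exp (J n)" and "B = exp (- J n)"
    and "p = exp (h (Suc n))" and "q = exp (- h (Suc n))"
  have rec: "?V s 1 = (?W s (-1) * B + ?W s 1 * A) * p"
       "?V s (-1) = (?W s (-1) * A + ?W s 1 * B) * q" for s
    using step.hyps
    by (simp_all add: boundary_weight_Suc A_def B_def p_def q_def exp_add exp_diff exp_minus
        divide_inverse algebra_simps)
  have "p * q = 1" by (simp add: p_def q_def exp_minus)
  moreover have "?V 1 1 * ?V (-1) (-1) - ?V 1 (-1) * ?V (-1) 1
      = (?W 1 1 * ?W (-1) (-1) - ?W 1 (-1) * ?W (-1) 1) * (A\<^sup>2 - B\<^sup>2) * (p * q)"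
    unfolding rec by algebra
  moreover have "A\<^sup>2 - B\<^sup>2 = exp (2 * J n) - exp (- 2 * J n)"
    by (simp add: A_def B_def power2_eq_square exp_add[symmetric])
  ultimately show ?case
    using step.hyps by (simp add: step.IH atLeastLessThanSuc mult.commute)
qed

section \<open>The covariance of the end spins\<close>

lemma covariance_map_pmf:
  "covariance (map_pmf f p) X Y = covariance p (\<lambda>\<omega>. X (f \<omega>)) (\<lambda>\<omega>. Y (f \<omega>))"
  by (simp add: covariance_def)

lemma covariance_eq_expectation_mult:
  assumes "finite (set_pmf p)"
  shows "covariance p X Y = measure_pmf.expectation p (\<lambda>\<omega>. X \<omega> * Y \<omega>)
    - measure_pmf.expectation p X * measure_pmf.expectation p Y"
proof -
  have [simp]: "integrable (measure_pmf p) f" for f :: "'a \<Rightarrow> real"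
    by (rule integrable_measure_pmf_finite[OF assms])
  show ?thesis by (simp add: covariance_def algebra_simps)
qed

lemma expectation_endpoints_gibbs_measure:
  assumes "a \<le> b"
  shows "measure_pmf.expectation (gibbs_measure a b J h) (\<lambda>\<sigma>. f (\<sigma> a) (\<sigma> b))
    = (\<Sum>s\<in>{-1, 1}. \<Sum>t\<in>{-1, 1}. f s t * boundary_weight a b J h s t)
      / partition_function a b J h"
proof -
  have "measure_pmf.expectation (gibbs_measure a b J h) (\<lambda>\<sigma>. f (\<sigma> a) (\<sigma> b))
      = (\<Sum>\<sigma>\<in>spin_configs a b. f (\<sigma> a) (\<sigma> b) * exp (- hamiltonian a b J h \<sigma>)
          / partition_function a b J h)"
    by (subst integral_measure_pmf_real[OF finite_spin_configs])
       (auto simp: set_gibbs_measure pmf_gibbs_measure intro!: sum.cong)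
  then show ?thesis
    by (simp only: sum_divide_distrib[symmetric] sum_endpoints_eq_boundary_weight[OF assms])
qed

lemma covariance_endpoints_gibbs_measure:
  assumes "a \<le> b"
  shows "covariance (gibbs_measure a b J h) (\<lambda>\<sigma>. \<sigma> a) (\<lambda>\<sigma>. \<sigma> b)
    = 4 * (\<Prod>x\<in>{a..<b}. exp (2 * J x) - exp (- 2 * J x)) / (partition_function a b J h)\<^sup>2"
proof -
  let ?W = "boundary_weight a b J h" and ?Z = "partition_function a b J h"
  let ?E = "\<lambda>f. \<Sum>s\<in>{-1, 1}. \<Sum>t\<in>{-1, 1}. f s t * ?W s t"
  have Z: "?Z = ?W 1 1 + ?W 1 (-1) + ?W (-1) 1 + ?W (-1) (-1)"
    using sum_endpoints_eq_boundary_weight[OF assms, of "\<lambda>_ _. 1" J h]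
    by (simp add: partition_function_def)
  have common_denominator: "x / ?Z - y / ?Z * (z / ?Z) = (x * ?Z - y * z) / ?Z\<^sup>2" for x y z
    using partition_function_pos[of a b J h] by (simp add: field_simps power2_eq_square)
  have "covariance (gibbs_measure a b J h) (\<lambda>\<sigma>. \<sigma> a) (\<lambda>\<sigma>. \<sigma> b)
      = ?E (*) / ?Z - ?E (\<lambda>s _. s) / ?Z * (?E (\<lambda>_ t. t) / ?Z)"
    using expectation_endpoints_gibbs_measure[OF assms, of J h "\<lambda>s _. s"]
      expectation_endpoints_gibbs_measure[OF assms, of J h "\<lambda>_ t. t"]
      expectation_endpoints_gibbs_measure[OF assms, of J h "(*)"]
    by (simp add: covariance_eq_expectation_mult set_gibbs_measure)
  also have "\<dots> = (?E (*) * ?Z - ?E (\<lambda>s _. s) * ?E (\<lambda>_ t. t)) / ?Z\<^sup>2"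
    by (rule common_denominator)
  also have "?E (*) * ?Z - ?E (\<lambda>s _. s) * ?E (\<lambda>_ t. t)
      = 4 * (?W 1 1 * ?W (-1) (-1) - ?W 1 (-1) * ?W (-1) 1)"
    unfolding Z by simp algebra
  finally show ?thesis by (simp only: boundary_weight_det[OF assms])
qed

section \<open>The bound\<close>

text \<open>The two constant configurations alone have the weight on the left.\<close>

lemma partition_function_ge_constant:
  assumes "a \<le> b"
  shows "2 * exp (\<Sum>x\<in>{a..<b}. J x) * cosh (\<Sum>x\<in>{a..b}. h x) \<le> partition_function a b J h"
proof -
  define c :: "real \<Rightarrow> nat \<Rightarrow> real" where "c s = restrict (\<lambda>_. s) {a..b}" for s
  have H: "- hamiltonian a b J h (c s) = (\<Sum>x\<in>{a..<b}. J x) + s * (\<Sum>x\<in>{a..b}. h x)"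
    if "s \<in> {-1, 1}" for s
    using that by (auto simp: hamiltonian_def c_def sum_negf)
  have two_exp_cosh: "2 * exp u * cosh v = exp (u + v) + exp (u - v)" for u v :: real
    unfolding diff_conv_add_uminus exp_add by (simp add: cosh_def distrib_left)
  have "c 1 a \<noteq> c (-1) a" using assms by (simp add: c_def)
  then have "c 1 \<noteq> c (-1)" by metis
  then have "2 * exp (\<Sum>x\<in>{a..<b}. J x) * cosh (\<Sum>x\<in>{a..b}. h x)
      = (\<Sum>\<sigma>\<in>{c 1, c (-1)}. exp (- hamiltonian a b J h \<sigma>))"
    by (simp add: H two_exp_cosh)
  also have "\<dots> \<le> partition_function a b J h"
    unfolding partition_function_def
    by (rule sum_mono2[OF finite_spin_configs]) (auto simp: c_def spin_configs_def)
  finally show ?thesis .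
qed

lemma tanh_factor_eq_exp:
  fixes y :: real
  shows "4 * tanh y / (1 + tanh y)\<^sup>2 = (exp (2 * y) - exp (- 2 * y)) / exp (2 * y)"
proof -
  define A B where "A = exp y" and "B = exp (- y)"
  define S where "S = A + B"
  have pos: "A > 0" "S > 0" by (simp_all add: A_def B_def S_def add_pos_pos)
  have t: "tanh y = (A - B) / S"
    by (simp add: tanh_altdef A_def B_def S_def)
  have t1: "1 + tanh y = 2 * A / S"
    unfolding t
    using pos by (simp add: S_def add_divide_distrib[symmetric] divide_add_eq_iff add_divide_eq_iff)
  have "4 * tanh y / (1 + tanh y)\<^sup>2 = (A - B) * S / A\<^sup>2"
    unfolding t1 unfolding t using pos by (simp add: field_simps power2_eq_square)
  then have "4 * tanh y / (1 + tanh y)\<^sup>2 = (A\<^sup>2 - B\<^sup>2) / A\<^sup>2"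
    by (simp add: S_def power2_eq_square algebra_simps)
  then show ?thesis
    by (simp add: A_def B_def power2_eq_square exp_add[symmetric])
qed

lemma covariance_endpoints_le:
  assumes "a \<le> b" and J: "\<And>x. x \<in> {a..<b} \<Longrightarrow> J x \<ge> 0"
  shows "covariance (gibbs_measure a b J h) (\<lambda>\<sigma>. \<sigma> a) (\<lambda>\<sigma>. \<sigma> b)
    \<le> (\<Prod>x\<in>{a..<b}. 4 * tanh (J x) / (1 + tanh (J x))\<^sup>2) * (1 / (cosh (\<Sum>x\<in>{a..b}. h x))\<^sup>2)"
proof -
  let ?Z = "partition_function a b J h" and ?C = "cosh (\<Sum>x\<in>{a..b}. h x)"
  let ?D = "\<Prod>x\<in>{a..<b}. exp (2 * J x) - exp (- 2 * J x)"
  let ?L = "2 * exp (\<Sum>x\<in>{a..<b}. J x) * ?C"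
  have "?D \<ge> 0" using J by (intro prod_nonneg) auto
  have "?L > 0" by (simp add: cosh_real_pos)
  have "covariance (gibbs_measure a b J h) (\<lambda>\<sigma>. \<sigma> a) (\<lambda>\<sigma>. \<sigma> b) = 4 * ?D / ?Z\<^sup>2"
    by (rule covariance_endpoints_gibbs_measure[OF assms(1)])
  also have "\<dots> \<le> 4 * ?D / ?L\<^sup>2"
  proof (rule divide_left_mono)
    show "?L\<^sup>2 \<le> ?Z\<^sup>2"
      using partition_function_ge_constant[OF assms(1)] \<open>?L > 0\<close> by (intro power_mono) auto
    show "0 \<le> 4 * ?D" using \<open>?D \<ge> 0\<close> by simp
    show "0 < ?Z\<^sup>2 * ?L\<^sup>2"
      using partition_function_pos[of a b J h] \<open>?L > 0\<close> by simp
  qed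
  also have "\<dots> = ?D / (exp (\<Sum>x\<in>{a..<b}. J x))\<^sup>2 * (1 / ?C\<^sup>2)"
    by (simp add: power_mult_distrib)
  also have "(exp (\<Sum>x\<in>{a..<b}. J x))\<^sup>2 = (\<Prod>x\<in>{a..<b}. exp (2 * J x))"
    by (simp add: exp_double exp_sum prod_power_distrib)
  finally show ?thesis
    by (simp only: tanh_factor_eq_exp prod_dividef)
qed

theorem theorem1p3:
  fixes N i j :: nat and J h :: "nat \<Rightarrow> real" and hi' hj' :: real
  assumes "N \<ge> 1"
    and "\<And>x. x < N \<Longrightarrow> J x \<ge> 0"
    and "\<And>x. x \<le> N \<Longrightarrow> h x \<ge> 0"
    and "i < j" and "j \<le> N"
    and "effective_fields N J h i j hi' hj'"
  shows "covariance (gibbs_measure 0 N J h) (\<lambda>\<sigma>. \<sigma> i) (\<lambda>\<sigma>. \<sigma> j)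
      \<le> (\<Prod>x\<in>{i..<j}. 4 * tanh (J x) / (1 + tanh (J x))\<^sup>2)
        * (1 / (cosh (hi' + (\<Sum>x\<in>{i<..<j}. h x) + hj'))\<^sup>2)"
proof -
  let ?h = "h(i := hi', j := hj')"
  have "covariance (gibbs_measure 0 N J h) (\<lambda>\<sigma>. \<sigma> i) (\<lambda>\<sigma>. \<sigma> j)
      = covariance (map_pmf (\<lambda>\<sigma>. restrict \<sigma> {i..j}) (gibbs_measure 0 N J h))
          (\<lambda>\<sigma>. \<sigma> i) (\<lambda>\<sigma>. \<sigma> j)"
    using \<open>i < j\<close> by (simp add: covariance_map_pmf)
  also have "\<dots> = covariance (gibbs_measure i j J ?h) (\<lambda>\<sigma>. \<sigma> i) (\<lambda>\<sigma>. \<sigma> j)"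
    using assms(6) by (simp only: effective_fields_def)
  also have "\<dots> \<le> (\<Prod>x\<in>{i..<j}. 4 * tanh (J x) / (1 + tanh (J x))\<^sup>2)
      * (1 / (cosh (\<Sum>x\<in>{i..j}. ?h x))\<^sup>2)"
    using assms by (intro covariance_endpoints_le) auto
  also have "(\<Sum>x\<in>{i..j}. ?h x) = hi' + (\<Sum>x\<in>{i<..<j}. h x) + hj'"
  proof -
    have "{i..j} = insert i (insert j {i<..<j})" using \<open>i < j\<close> by auto
    then show ?thesis using \<open>i < j\<close> by simp
  qed
  finally show ?thesis .
qed

end
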